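(* Let $f:\mathcal P\to\mathbb C$ be an arbitrary function. If $F:\mathcal P\to\mathbb C$ is given by $$F(\lambda)=\sum_{\delta|\lambda}f(\delta)\qquad(\lambda\in\mathcal P),$$ then, in $\mathbb C[[q]]$, $$\left<F\right>_q=\sum_{\lambda\in\mathcal P}f(\lambda)q^{|\lambda|}.$$
   Context: $\mathcal P$ is the set of all integer partitions $\lambda=(\lambda_1,\dots,\lambda_r)$, $\lambda_1\ge\cdots\ge\lambda_r\ge1$, including the empty partition $\emptyset$. The size is $|\lambda|=\lambda_1+\cdots+\lambda_r$, with $|\emptyset|=0$. A partition $\delta$ divides $\lambda$, written $\delta|\lambda$, if all parts of $\delta$ are also parts of $\lambda$, including multiplicity (i.e. $\delta$ is a sub-multiset of $\lambda$); $\emptyset$ divides every partition. A sum over $\delta|\lambda$ runs over the distinct partitions $\delta$ dividing $\lambda$ (each counted once). For a function $f:\mathcal P\to\mathbb C$ the $q$-bracket is $$\left<f\right>_q:=\frac{\sum_{\lambda\in\mathcal P}f(\lambda)q^{|\lambda|}}{\sum_{\lambda\in\mathcal P}q^{|\lambda|}}\in\mathbb C[[q]].$$ *)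

theory Defs
  imports
    "HOL-Analysis.Infinite_Sum"
    "HOL-Library.Multiset"
    "HOL-Computational_Algebra.Formal_Power_Series"
begin

text \<open>
  A partition is represented by the finite multiset of its parts.
  Then \<open>\<delta>\<close> divides \<open>\<mu>\<close> iff \<open>\<delta> \<subseteq># \<mu>\<close>, and \<open>{#}\<close> is the empty partition.
\<close>

definition int_partitions :: "nat multiset set" where
  "int_partitions = {\<mu>. \<forall>k \<in># \<mu>. 1 \<le> k}"

text \<open>
  Infinite sums are taken in the metric topology of \<open>complex fps\<close>, i.e. the usual
  \<open>q\<close>-adic one. They always converge by \<open>has_sum_int_partitions\<close> below, so the default value
  of \<open>infsum\<close> for families that are not summable plays no role.
\<close>

definition q_bracket :: "(nat multiset \<Rightarrow> complex) \<Rightarrow> complex fps" where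
  "q_bracket f =
     (\<Sum>\<^sub>\<infinity>\<mu>\<in>int_partitions. fps_const (f \<mu>) * fps_X ^ (\<Sum>\<^sub># \<mu>)) /
     (\<Sum>\<^sub>\<infinity>\<mu>\<in>int_partitions. fps_X ^ (\<Sum>\<^sub># \<mu>))"

lemma finite_int_partitions_le: "finite {\<mu> \<in> int_partitions. \<Sum>\<^sub># \<mu> \<le> n}"
proof (rule finite_subset)
  show "{\<mu> \<in> int_partitions. \<Sum>\<^sub># \<mu> \<le> n} \<subseteq> mset ` {xs. set xs \<subseteq> {..n} \<and> length xs \<le> n}"
  proof
    fix \<mu> assume "\<mu> \<in> {\<mu> \<in> int_partitions. \<Sum>\<^sub># \<mu> \<le> n}"
    then have pos: "\<forall>k \<in># \<mu>. 1 \<le> k" and le: "\<Sum>\<^sub># \<mu> \<le> n"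
      by (auto simp: int_partitions_def)
    obtain xs where xs: "\<mu> = mset xs"
      by (metis ex_mset)
    have len: "length ys \<le> sum_list ys" if "\<forall>k \<in> set ys. 1 \<le> k" for ys :: "nat list"
      using that by (induction ys) auto
    have sum: "sum_list xs \<le> n"
      using le xs by (simp add: sum_mset_sum_list)
    have "length xs \<le> n"
      using len[of xs] sum pos xs by simp
    moreover have "k \<le> n" if "k \<in> set xs" for k
      using member_le_sum_list[OF that] sum by simp
    ultimately show "\<mu> \<in> mset ` {xs. set xs \<subseteq> {..n} \<and> length xs \<le> n}"
      using xs by auto
  qed
  show "finite (mset ` {xs. set xs \<subseteq> {..n} \<and> length xs \<le> n})"
    by (intro finite_imageI finite_lists_length_le) auto
qed

lemma has_sum_int_partitions:
  fixes f :: "nat multiset \<Rightarrow> complex"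
  shows "((\<lambda>\<mu>. fps_const (f \<mu>) * fps_X ^ (\<Sum>\<^sub># \<mu>)) has_sum
     Abs_fps (\<lambda>n. \<Sum>\<mu> | \<mu> \<in> int_partitions \<and> \<Sum>\<^sub># \<mu> = n. f \<mu>)) int_partitions"
  unfolding has_sum_def
proof (rule tendsto_fpsI)
  let ?S = "Abs_fps (\<lambda>n. \<Sum>\<mu> | \<mu> \<in> int_partitions \<and> \<Sum>\<^sub># \<mu> = n. f \<mu>)"
  let ?g = "\<lambda>\<mu>. fps_const (f \<mu>) * fps_X ^ (\<Sum>\<^sub># \<mu>)"
  fix n :: nat
  let ?A = "{\<mu> \<in> int_partitions. \<Sum>\<^sub># \<mu> \<le> n}"
  show "\<forall>\<^sub>F X in finite_subsets_at_top int_partitions. fps_nth (sum ?g X) n = fps_nth ?S n"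
    unfolding eventually_finite_subsets_at_top
  proof (intro exI[of _ ?A] conjI allI impI)
    show "finite ?A"
      by (rule finite_int_partitions_le)
    show "?A \<subseteq> int_partitions"
      by auto
    fix X assume X: "finite X \<and> ?A \<subseteq> X \<and> X \<subseteq> int_partitions"
    have "fps_nth (sum ?g X) n = (\<Sum>\<mu>\<in>X. if \<Sum>\<^sub># \<mu> = n then f \<mu> else 0)"
      by (auto simp: fps_sum_nth fps_X_power_nth intro!: sum.cong)
    also have "\<dots> = (\<Sum>\<mu> | \<mu> \<in> X \<and> \<Sum>\<^sub># \<mu> = n. f \<mu>)"
      using X by (simp add: sum.inter_filter)
    also have "{\<mu>. \<mu> \<in> X \<and> \<Sum>\<^sub># \<mu> = n} = {\<mu>. \<mu> \<in> int_partitions \<and> \<Sum>\<^sub># \<mu> = n}"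
      using X by auto
    finally show "fps_nth (sum ?g X) n = fps_nth ?S n"
      by simp
  qed
qed

end

theory Submission
  imports Defs
begin

text \<open>
  Cutting \<open>\<mu>\<close> into a divisor \<open>\<delta>\<close> and the complementary divisor \<open>\<nu> = \<mu> - \<delta>\<close> is a bijection
  between the pairs \<open>(\<mu>, \<delta>)\<close> with \<open>\<delta> \<subseteq># \<mu>\<close> and all pairs \<open>(\<delta>, \<nu>)\<close> of partitions; its inverse
  is \<open>(\<delta>, \<nu>) \<mapsto> (\<delta> + \<nu>, \<delta>)\<close>, and sizes add up. Weighting each pair by \<open>f \<delta>\<close>, the generating
  function of the divisor sums \<open>F\<close> is thus the generating function of \<open>f\<close> times that of the
  constant function 1 (\<open>partition_gf_divisor_sum\<close>). The second factor is exactly the denominator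
  of the \<open>q\<close>-bracket, and it cancels because its constant coefficient counts only the empty
  partition.
\<close>

definition partition_gf :: "(nat multiset \<Rightarrow> complex) \<Rightarrow> complex fps" where
  "partition_gf f = Abs_fps (\<lambda>n. \<Sum>\<mu> | \<mu> \<in> int_partitions \<and> \<Sum>\<^sub># \<mu> = n. f \<mu>)"

lemma infsum_int_partitions:
  "(\<Sum>\<^sub>\<infinity>\<mu>\<in>int_partitions. fps_const (f \<mu>) * fps_X ^ (\<Sum>\<^sub># \<mu>)) = partition_gf f"
  unfolding partition_gf_def by (rule infsumI[OF has_sum_int_partitions])

lemma q_bracket_eq_partition_gf: "q_bracket f = partition_gf f / partition_gf (\<lambda>_. 1)"
  using infsum_int_partitions[of f] infsum_int_partitions[of "\<lambda>_. 1"]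
  by (simp add: q_bracket_def)

lemma partition_gf_one_nonzero: "partition_gf (\<lambda>_. 1) \<noteq> 0"
proof -
  have "\<mu> = {#}" if "\<forall>k \<in># \<mu>. 1 \<le> k" and "\<Sum>\<^sub># \<mu> = 0" for \<mu> :: "nat multiset"
    using that by (cases \<mu>) auto
  then have "{\<mu> \<in> int_partitions. \<Sum>\<^sub># \<mu> = 0} = {{#}}"
    unfolding int_partitions_def by fastforce
  then have "fps_nth (partition_gf (\<lambda>_. 1)) 0 = 1"
    by (simp add: partition_gf_def)
  then show ?thesis
    by auto
qed

lemma finite_int_partitions_eq: "finite {\<mu> \<in> int_partitions. \<Sum>\<^sub># \<mu> = n}"
  by (rule finite_subset[OF _ finite_int_partitions_le[of n]]) auto

lemma sum_mset_subset_le: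
  fixes \<delta> \<mu> :: "nat multiset"
  assumes "\<delta> \<subseteq># \<mu>"
  shows "\<Sum>\<^sub># \<delta> \<le> \<Sum>\<^sub># \<mu>"
  using assms by (auto simp: subset_mset.le_iff_add)

lemma finite_partition_divisors: "finite {\<delta> \<in> int_partitions. \<delta> \<subseteq># \<mu>}"
  by (rule finite_subset[OF _ finite_int_partitions_le[of "\<Sum>\<^sub># \<mu>"]])
     (auto dest: sum_mset_subset_le)

text \<open>
  Comparing coefficients of \<open>q ^ n\<close>, the bijection \<open>(\<mu>, \<delta>) \<mapsto> (\<delta>, \<mu> - \<delta>)\<close> acts on the pairs with
  \<open>\<mu>\<close> of size \<open>n\<close>. The Cauchy product also records the size \<open>i\<close> of \<open>\<delta>\<close>, so the bijection is
  made to produce the triple \<open>(i, \<delta>, \<mu> - \<delta>)\<close>.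
\<close>

lemma partition_gf_divisor_sum:
  "partition_gf (\<lambda>\<mu>. \<Sum>\<delta> | \<delta> \<in> int_partitions \<and> \<delta> \<subseteq># \<mu>. f \<delta>)
     = partition_gf f * partition_gf (\<lambda>_. 1)"
proof (rule fps_ext)
  fix n
  let ?P = "\<lambda>i. {\<mu> \<in> int_partitions. \<Sum>\<^sub># \<mu> = i}"
  let ?D = "\<lambda>\<mu>. {\<delta> \<in> int_partitions. \<delta> \<subseteq># \<mu>}"
  have "(\<Sum>\<mu>\<in>?P n. \<Sum>\<delta>\<in>?D \<mu>. f \<delta>) = (\<Sum>(\<mu>, \<delta>)\<in>Sigma (?P n) ?D. f \<delta>)"
    by (intro sum.Sigma ballI finite_int_partitions_eq finite_partition_divisors)
  also have "\<dots> = (\<Sum>(i, \<delta>, \<nu>)\<in>(SIGMA i:{0..n}. ?P i \<times> ?P (n - i)). f \<delta>)"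
    by (rule sum.reindex_bij_witness[where
          i = "\<lambda>(i, \<delta>, \<nu>). (\<delta> + \<nu>, \<delta>)" and j = "\<lambda>(\<mu>, \<delta>). (\<Sum>\<^sub># \<delta>, \<delta>, \<mu> - \<delta>)"])
       (auto simp: int_partitions_def sum_mset_subset_le subset_mset.le_iff_add)
  also have "\<dots> = (\<Sum>i=0..n. \<Sum>(\<delta>, \<nu>)\<in>?P i \<times> ?P (n - i). f \<delta>)"
    by (subst sum.Sigma) (auto simp: finite_int_partitions_eq)
  also have "\<dots> = (\<Sum>i=0..n. (\<Sum>\<delta>\<in>?P i. f \<delta>) * (\<Sum>\<nu>\<in>?P (n - i). 1))"
    by (simp add: sum.cartesian_product[symmetric] sum_distrib_right mult.commute)
  finally show "fps_nth (partition_gf (\<lambda>\<mu>. \<Sum>\<delta>\<in>?D \<mu>. f \<delta>)) n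
      = fps_nth (partition_gf f * partition_gf (\<lambda>_. 1)) n"
    by (simp add: partition_gf_def fps_mult_nth)
qed

theorem theorem4p1:
  fixes f F :: "nat multiset \<Rightarrow> complex"
  assumes "\<And>\<mu>. \<mu> \<in> int_partitions \<Longrightarrow>
             F \<mu> = (\<Sum>\<delta> | \<delta> \<in> int_partitions \<and> \<delta> \<subseteq># \<mu>. f \<delta>)"
  shows "q_bracket F =
           (\<Sum>\<^sub>\<infinity>\<mu>\<in>int_partitions. fps_const (f \<mu>) * fps_X ^ (\<Sum>\<^sub># \<mu>))"
proof -
  have "partition_gf F = partition_gf (\<lambda>\<mu>. \<Sum>\<delta> | \<delta> \<in> int_partitions \<and> \<delta> \<subseteq># \<mu>. f \<delta>)"
    unfolding partition_gf_def by (intro arg_cong[where f = Abs_fps] ext sum.cong) (auto simp: assms)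
  also have "\<dots> = partition_gf f * partition_gf (\<lambda>_. 1)"
    by (rule partition_gf_divisor_sum)
  finally show ?thesis
    by (simp add: q_bracket_eq_partition_gf infsum_int_partitions partition_gf_one_nonzero)
qed

end
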